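(* Let $\mathbb H=(V,\mathcal H)$ be a complete $3$-uniform hypergraph of order $q=|V|\ge 4$. Then for every admissible matching policy $\Phi$, $$\mathrm{Stab}(\mathbb H,\Phi)=\left\{\mu\in\mathscr M(V):\ \mu(i)<\tfrac13\ \text{ for all } i\in V\right\},$$ that is, the model $(\mathbb H,\Phi,\mu)$ is stable if and only if $\mu(i)<1/3$ for any $i\in V$.
   Context: A hypergraph $\mathbb H=(V,\mathcal H)$ consists of a finite node set $V$ and a finite set $\mathcal H$ of subsets of $V$ (hyperedges) whose union is $V$. It is complete $3$-uniform if $\mathcal H$ is the set of all subsets of $V$ of cardinality $3$. $\mathscr M(V)$ is the set of probability measures $\mu$ on $V$ with $\mu(i)>0$ for all $i\in V$. Matching model $(\mathbb H,\Phi,\mu)$: at each time $n\ge1$ one item enters; its class $C_n\in V$ is drawn from $\mu$, and $(C_n)_n$ is i.i.d. If the buffer contains a set of items whose classes form, together with $C_n$, a hyperedge of $\mathcal H$ (one item per class), then the policy $\Phi$ selects one such set and all these items together with the incoming item leave the system immediately (so policies are non-idling: a match is always performed whenever possible); otherwise the incoming item is stored in the buffer. The queue detail $W_n$ is the finite word over the alphabet $V$ listing the classes of unmatched items just after the arrival at time $n$, in order of arrival; it takes values in the set of words $w$ such that for each $H\in\mathcal H$ some $i\in H$ does not occur in $w$. The policy $\Phi$ is admissible if the choice of the match of an incoming item depends solely on the queue detail upon arrival (and the incoming class), and possibly on an independent uniform draw in case of a tie. Then $(W_n)_{n\in\mathbb N}$ is a Markov chain. The model is stable if this chain is positive recurrent,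 and $\mathrm{Stab}(\mathbb H,\Phi)$ is the set of $\mu\in\mathscr M(V)$ such that $(\mathbb H,\Phi,\mu)$ is stable. *)

theory Defs
  imports "HOL-Probability.Probability"
begin

definition hypergraph :: "'a set \<Rightarrow> 'a set set \<Rightarrow> bool" where
  "hypergraph V \<H> \<longleftrightarrow> finite V \<and> finite \<H> \<and> \<H> \<subseteq> Pow V \<and> \<Union>\<H> = V"

definition complete_3_uniform :: "'a set \<Rightarrow> 'a set set \<Rightarrow> bool" where
  "complete_3_uniform V \<H> \<longleftrightarrow> hypergraph V \<H> \<and> \<H> = {H. H \<subseteq> V \<and> card H = 3}"

text \<open>Encodes: \<open>\<mu>\<close> is concentrated on \<open>V\<close> and \<open>pmf \<mu> i > 0\<close> for all \<open>i \<in> V\<close>.\<close>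

definition full_measures :: "'a set \<Rightarrow> 'a pmf set" where
  "full_measures V = {\<mu>. set_pmf \<mu> = V}"

text \<open>
  The (time-homogeneous) Markov chain \<open>X\<^sub>0 = x\<close>, \<open>X\<^sub>n\<^sub>+\<^sub>1 = f X\<^sub>n \<xi>\<^sub>n\<^sub>+\<^sub>1\<close> driven by an i.i.d. sequence
  of inputs; the entry \<open>\<omega> !! n\<close> of the stream \<open>\<omega>\<close> is the input \<open>\<xi>\<^sub>n\<^sub>+\<^sub>1\<close> of time \<open>n + 1\<close>.
\<close>

primrec chain :: "('s \<Rightarrow> 'e \<Rightarrow> 's) \<Rightarrow> 's \<Rightarrow> 'e stream \<Rightarrow> nat \<Rightarrow> 's" where
  "chain f x \<omega> 0 = x"
| "chain f x \<omega> (Suc n) = f (chain f x \<omega> n) (\<omega> !! n)"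

text \<open>The infimum of the empty set is \<open>\<infinity>\<close> here: the return time is infinite without a return.\<close>

definition return_time :: "('s \<Rightarrow> 'e \<Rightarrow> 's) \<Rightarrow> 's \<Rightarrow> 'e stream \<Rightarrow> ennreal" where
  "return_time f x \<omega> = (INF n\<in>{n. 1 \<le> n \<and> chain f x \<omega> n = x}. of_nat n)"

text \<open>
  Every state of \<open>S\<close> has a finite expected return time, where the inputs are i.i.d. with law \<open>M\<close>.
  Finiteness of the expectation includes that the return time is almost surely finite.
\<close>

definition positive_recurrent :: "'s set \<Rightarrow> 'e measure \<Rightarrow> ('s \<Rightarrow> 'e \<Rightarrow> 's) \<Rightarrow> bool" where
  "positive_recurrent S M f \<longleftrightarrow>
     (\<forall>x\<in>S. (\<integral>\<^sup>+ \<omega>. return_time f x \<omega> \<partial>stream_space M) < \<infinity>)"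

text \<open>
  Queue details are words, oldest item first. A set of stored items is encoded by the set of its
  positions in the queue detail, so that a policy may distinguish items of the same class.
\<close>

definition queue_details :: "'a set \<Rightarrow> 'a set set \<Rightarrow> 'a list set" where
  "queue_details V \<H> = {w \<in> lists V. \<forall>H\<in>\<H>. \<exists>i\<in>H. i \<notin> set w}"

definition matches :: "'a set set \<Rightarrow> 'a list \<Rightarrow> 'a \<Rightarrow> nat set set" where
  "matches \<H> w c = {P. P \<subseteq> {..<length w} \<and> inj_on ((!) w) P \<and>
                       c \<notin> (!) w ` P \<and> insert c ((!) w ` P) \<in> \<H>}"

text \<open>
  The arguments of a policy are the queue detail upon arrival, the incoming class and an auxiliary
  draw, which is uniform on \<open>[0, 1]\<close> and can be used to break ties in an arbitrary randomized way.
\<close>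

type_synonym 'a policy = "'a list \<Rightarrow> 'a \<Rightarrow> real \<Rightarrow> nat set"

definition admissible :: "'a set \<Rightarrow> 'a set set \<Rightarrow> 'a policy \<Rightarrow> bool" where
  "admissible V \<H> \<Phi> \<longleftrightarrow>
     (\<forall>w\<in>queue_details V \<H>. \<forall>c\<in>V.
        \<Phi> w c \<in> measurable borel (count_space UNIV) \<and>
        (matches \<H> w c \<noteq> {} \<longrightarrow> (\<forall>u\<in>{0..1}. \<Phi> w c u \<in> matches \<H> w c)))"

definition arrival :: "'a set set \<Rightarrow> 'a policy \<Rightarrow> 'a list \<Rightarrow> 'a \<times> real \<Rightarrow> 'a list" where
  "arrival \<H> \<Phi> w = (\<lambda>(c, u). if matches \<H> w c = {} then w @ [c] else nths w (- \<Phi> w c u))"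

text \<open>
  The chain below is \<open>(W\<^sub>n)\<close>, on the state space of all queue details; its inputs are the
  pairs of the incoming class \<open>C\<^sub>n\<close>, of law \<open>\<mu>\<close>, and an independent uniform draw.
\<close>

definition stable :: "'a set \<Rightarrow> 'a set set \<Rightarrow> 'a policy \<Rightarrow> 'a pmf \<Rightarrow> bool" where
  "stable V \<H> \<Phi> \<mu> \<longleftrightarrow>
     positive_recurrent (queue_details V \<H>)
       (measure_pmf \<mu> \<Otimes>\<^sub>M uniform_measure lborel {0..1::real}) (arrival \<H> \<Phi>)"

definition Stab :: "'a set \<Rightarrow> 'a set set \<Rightarrow> 'a policy \<Rightarrow> 'a pmf set" where
  "Stab V \<H> \<Phi> = {\<mu> \<in> full_measures V. stable V \<H> \<Phi> \<mu>}"

end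

theory Submission
  imports Defs
begin

text \<open>
  A queue detail contains at most two classes, and a match happens exactly when two classes are stored
  and a third one arrives; it takes one item of each stored class. The policy only chooses which
  items of a class leave, so the vector \<open>n\<close> of class counts, of total \<open>N\<close>, does not feel it.

  Sufficiency. The energy \<open>L = (3 (\<Sum>j. n\<^sub>j\<^sup>2) - N\<^sup>2) / 2\<close> is nonnegative, as at most two counts are nonzero, and
  removing a match does not change it. An arrival of class \<open>c\<close> thus always changes it by \<open>3 n\<^sub>c - N + 1\<close>,
  and if \<open>3 \<mu>(c) \<le> 1 - \<epsilon>\<close> for all \<open>c\<close>, its drift is at most \<open>1 - \<epsilon> N\<close> (\<open>energy_arrival\<close>, \<open>energy_drift\<close>). The drift
  is at most \<open>-1\<close> outside a finite set of words, and all words communicate (\<open>reaches_all\<close>), so Foster's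
  criterion (\<open>foster\<close>) makes the mean return time of every word finite.

  Necessity. The excess \<open>3 n\<^sub>i - N\<close> never decreases when a match is removed, so its drift is at
  least \<open>3 \<mu>(i) - 1\<close> (\<open>excess_arrival\<close>). If this is nonnegative and the empty word has finite mean return time,
  optional stopping at the emptying time, started from the word \<open>[i]\<close>, shows that the excess \<open>2\<close> of \<open>[i]\<close> is at
  most the excess \<open>0\<close> of the empty word (\<open>subharmonic_vanishes\<close>, \<open>below_third_if_stable\<close>). The boundary
  case \<open>\<mu>(i) = 1/3\<close> is included, because only subharmonicity is used.

  Both directions are first-step arguments about functions on the state space: mean hitting times are the limits of
  recursively defined truncated means, against which the test functions are compared by induction.
\<close>

section \<open>Return times and hitting times\<close>

text \<open>
  The minimum runs over all \<open>n\<close>, and times at which the chain is elsewhere contribute \<open>\<infinity>\<close>, so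
  that adding one step commutes with the infimum also when the state is never reached.
\<close>

definition hit_time :: "('s \<Rightarrow> 'e \<Rightarrow> 's) \<Rightarrow> 's \<Rightarrow> 's \<Rightarrow> 'e stream \<Rightarrow> ennreal" where
  "hit_time f x y \<omega> = (INF n. if chain f y \<omega> n = x then of_nat n else \<top>)"

lemma chain_Stream: "chain f y (e ## \<omega>) (Suc n) = chain f (f y e) \<omega> n"
  by (induction n) auto

text \<open>
  First-step analysis is carried by the hitting time of a state, which is \<open>0\<close> at the state itself;
  the return time is one step followed by a hitting time.
\<close>

lemma return_time_Stream: "return_time f x (e ## \<omega>) = 1 + hit_time f x (f x e) \<omega>"
proof -
  have "return_time f x (e ## \<omega>) = (INF n. 1 + (if chain f (f x e) \<omega> n = x then of_nat n else \<top>))"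
  proof (rule antisym)
    show "return_time f x (e ## \<omega>) \<le> (INF n. 1 + (if chain f (f x e) \<omega> n = x then of_nat n else \<top>))"
    proof (rule INF_greatest)
      fix n
      show "return_time f x (e ## \<omega>) \<le> 1 + (if chain f (f x e) \<omega> n = x then of_nat n else \<top>)"
      proof (cases "chain f (f x e) \<omega> n = x")
        case True
        then have "return_time f x (e ## \<omega>) \<le> of_nat (Suc n)"
          unfolding return_time_def by (intro INF_lower) (simp add: chain_Stream del: chain.simps)
        then show ?thesis using True by simp
      qed simp
    qed
    show "(INF n. 1 + (if chain f (f x e) \<omega> n = x then of_nat n else \<top>)) \<le> return_time f x (e ## \<omega>)"
      unfolding return_time_def
    proof (rule INF_greatest)
      fix m assume m: "m \<in> {n. 1 \<le> n \<and> chain f x (e ## \<omega>) n = x}"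
      then obtain n where n: "m = Suc n" by (cases m) auto
      have "(INF n. 1 + (if chain f (f x e) \<omega> n = x then of_nat n else (\<top>::ennreal)))
            \<le> 1 + (if chain f (f x e) \<omega> n = x then of_nat n else \<top>)"
        by (rule INF_lower) simp
      also have "\<dots> = of_nat m" using m n by (simp add: chain_Stream del: chain.simps)
      finally show "(INF n. 1 + (if chain f (f x e) \<omega> n = x then of_nat n else (\<top>::ennreal))) \<le> of_nat m" .
    qed
  qed
  then show ?thesis by (simp add: hit_time_def INF_ennreal_const_add)
qed

lemma hit_time_self: "hit_time f x x \<omega> = 0"
proof -
  have "hit_time f x x \<omega> \<le> (if chain f x \<omega> 0 = x then of_nat 0 else \<top>)"
    unfolding hit_time_def by (rule INF_lower) simp
  then show ?thesis by simp
qed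

lemma hit_time_Stream:
  assumes "y \<noteq> x"
  shows "hit_time f x y (e ## \<omega>) = 1 + hit_time f x (f y e) \<omega>"
proof -
  have "hit_time f x y (e ## \<omega>) = (INF n. 1 + (if chain f (f y e) \<omega> n = x then of_nat n else \<top>))"
    unfolding hit_time_def
  proof (rule antisym)
    show "(INF n. if chain f y (e ## \<omega>) n = x then of_nat n else \<top>)
          \<le> (INF n. 1 + (if chain f (f y e) \<omega> n = x then of_nat n else (\<top>::ennreal)))"
    proof (rule INF_greatest)
      fix n
      show "(INF n. if chain f y (e ## \<omega>) n = x then of_nat n else \<top>)
          \<le> 1 + (if chain f (f y e) \<omega> n = x then of_nat n else (\<top>::ennreal))"
        by (rule INF_lower2[of "Suc n"]) (auto simp: chain_Stream simp del: chain.simps)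
    qed
    show "(INF n. 1 + (if chain f (f y e) \<omega> n = x then of_nat n else \<top>))
          \<le> (INF n. if chain f y (e ## \<omega>) n = x then of_nat n else (\<top>::ennreal))"
    proof (rule INF_greatest)
      fix m
      show "(INF n. 1 + (if chain f (f y e) \<omega> n = x then of_nat n else \<top>))
          \<le> (if chain f y (e ## \<omega>) m = x then of_nat m else (\<top>::ennreal))"
      proof (cases m)
        case 0 then show ?thesis using assms by simp
      next
        case (Suc n)
        show ?thesis unfolding Suc chain_Stream
          by (rule INF_lower2[of n]) auto
      qed
    qed
  qed
  then show ?thesis by (simp add: hit_time_def INF_ennreal_const_add)
qed

section \<open>Mean hitting times of countable chains\<close>

text \<open>
  The measurability assumption also says that \<open>S\<close> is closed under \<open>f\<close> for all inputs in the space of \<open>M\<close>.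
  Countability of \<open>S\<close> makes every function of the state measurable, so that expectations after one
  step need no side conditions on the function.
\<close>

locale driven_chain = prob_space M for M :: "'e measure" +
  fixes S :: "'s set" and f :: "'s \<Rightarrow> 'e \<Rightarrow> 's"
  assumes countable_states: "countable S"
    and step_measurable: "w \<in> S \<Longrightarrow> f w \<in> M \<rightarrow>\<^sub>M count_space S"
begin

lemma step_in: "w \<in> S \<Longrightarrow> e \<in> space M \<Longrightarrow> f w e \<in> S"
  using measurable_space[OF step_measurable] by simp

lemma step_fun_measurable [measurable]:
  "w \<in> S \<Longrightarrow> (\<lambda>e. (g :: 's \<Rightarrow> ennreal) (f w e)) \<in> borel_measurable M"
  by (rule measurable_compose[OF step_measurable]) auto

lemma chain_measurable:
  assumes "y \<in> S"
  shows "(\<lambda>\<omega>. chain f y \<omega> n) \<in> stream_space M \<rightarrow>\<^sub>M count_space S"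
proof (induction n)
  case 0 then show ?case using assms by simp
next
  case (Suc n)
  have "(\<lambda>\<omega>. f w (\<omega> !! n)) \<in> stream_space M \<rightarrow>\<^sub>M count_space S" if "w \<in> S" for w
    using measurable_compose[OF measurable_snth step_measurable[OF that]] .
  from measurable_compose_countable'[OF this Suc countable_states] show ?case by simp
qed

lemma hit_time_measurable [measurable]:
  assumes "y \<in> S"
  shows "hit_time f x y \<in> borel_measurable (stream_space M)"
proof -
  have "(\<lambda>\<omega>. if chain f y \<omega> n = x then of_nat n else \<top>::ennreal) \<in> borel_measurable (stream_space M)" for n
    by (rule measurable_compose[OF chain_measurable[OF assms]]) auto
  then show ?thesis unfolding hit_time_def[abs_def] by measurable
qed

definition mean_hit :: "'s \<Rightarrow> 's \<Rightarrow> ennreal" where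
  "mean_hit x y = (\<integral>\<^sup>+\<omega>. hit_time f x y \<omega> \<partial>stream_space M)"

text \<open>
  These two are \<open>E\<^sub>y min(T, n)\<close> and \<open>P\<^sub>y(T \<le> n)\<close> for the hitting time \<open>T\<close> of \<open>x\<close>. Defined by
  first-step recursion, they can be compared with test functions by induction on \<open>n\<close>, without
  stopped processes.
\<close>

primrec mean_hit_upto :: "'s \<Rightarrow> nat \<Rightarrow> 's \<Rightarrow> ennreal" where
  "mean_hit_upto x 0 y = 0"
| "mean_hit_upto x (Suc n) y = (if y = x then 0 else 1 + (\<integral>\<^sup>+e. mean_hit_upto x n (f y e) \<partial>M))"

primrec hit_prob :: "'s \<Rightarrow> nat \<Rightarrow> 's \<Rightarrow> ennreal" where
  "hit_prob x 0 y = (if y = x then 1 else 0)"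
| "hit_prob x (Suc n) y = (if y = x then 1 else (\<integral>\<^sup>+e. hit_prob x n (f y e) \<partial>M))"

lemma nn_integral_one_plus:
  "w \<in> S \<Longrightarrow> (\<integral>\<^sup>+e. 1 + (g :: 's \<Rightarrow> ennreal) (f w e) \<partial>M) = 1 + (\<integral>\<^sup>+e. g (f w e) \<partial>M)"
  by (subst nn_integral_add) (auto simp: emeasure_space_1)

lemma mean_hit_step:
  assumes "y \<in> S"
  shows "mean_hit x y = (if y = x then 0 else 1 + (\<integral>\<^sup>+e. mean_hit x (f y e) \<partial>M))"
proof (cases "y = x")
  case False
  interpret st: prob_space "stream_space M" by (rule prob_space_stream_space)
  have "mean_hit x y = (\<integral>\<^sup>+e. (\<integral>\<^sup>+\<omega>. 1 + hit_time f x (f y e) \<omega> \<partial>stream_space M) \<partial>M)"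
    unfolding mean_hit_def using assms False
    by (subst nn_integral_stream_space) (auto simp: hit_time_Stream)
  also have "\<dots> = (\<integral>\<^sup>+e. 1 + mean_hit x (f y e) \<partial>M)"
    unfolding mean_hit_def using assms
    by (intro nn_integral_cong, subst nn_integral_add)
       (auto simp: step_in st.emeasure_space_1)
  finally show ?thesis using False assms by (simp add: nn_integral_one_plus)
qed (simp add: mean_hit_def hit_time_self)

lemma mean_return_time:
  assumes "x \<in> S"
  shows "(\<integral>\<^sup>+\<omega>. return_time f x \<omega> \<partial>stream_space M) = 1 + (\<integral>\<^sup>+e. mean_hit x (f x e) \<partial>M)"
proof -
  interpret st: prob_space "stream_space M" by (rule prob_space_stream_space)
  have "return_time f x = (\<lambda>\<omega>. 1 + hit_time f x (f x (shd \<omega>)) (stl \<omega>))"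
    by (rule ext) (metis return_time_Stream stream.collapse)
  moreover have "(\<lambda>\<omega>. 1 + hit_time f x (f x (shd \<omega>)) (stl \<omega>)) \<in> borel_measurable (stream_space M)"
  proof -
    have "(\<lambda>\<omega>. hit_time f x (f x (shd \<omega>)) (stl \<omega>)) \<in> borel_measurable (stream_space M)"
      by (rule measurable_compose_countable'[OF _ measurable_compose[OF measurable_shd step_measurable[OF assms]]
            countable_states])
         (rule measurable_compose[OF measurable_stl], rule hit_time_measurable)
    then show ?thesis by measurable
  qed
  ultimately have "(\<integral>\<^sup>+\<omega>. return_time f x \<omega> \<partial>stream_space M)
      = (\<integral>\<^sup>+e. (\<integral>\<^sup>+\<omega>. 1 + hit_time f x (f x e) \<omega> \<partial>stream_space M) \<partial>M)"
    by (simp add: nn_integral_stream_space)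
  also have "\<dots> = (\<integral>\<^sup>+e. 1 + mean_hit x (f x e) \<partial>M)"
    unfolding mean_hit_def using assms
    by (intro nn_integral_cong, subst nn_integral_add)
       (auto simp: step_in st.emeasure_space_1)
  finally show ?thesis using assms by (simp add: nn_integral_one_plus)
qed

lemma mean_hit_upto_eq:
  "y \<in> S \<Longrightarrow> mean_hit_upto x n y = (\<integral>\<^sup>+\<omega>. min (hit_time f x y \<omega>) (of_nat n) \<partial>stream_space M)"
proof (induction n arbitrary: y)
  case 0 then show ?case by simp
next
  case (Suc n)
  interpret st: prob_space "stream_space M" by (rule prob_space_stream_space)
  show ?case
  proof (cases "y = x")
    case False
    have mn: "min (1 + a) (1 + of_nat n) = 1 + min a (of_nat n)" for a :: ennreal
      by (auto simp: min_def)
    have "(\<integral>\<^sup>+\<omega>. min (hit_time f x y \<omega>) (of_nat (Suc n)) \<partial>stream_space M)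
        = (\<integral>\<^sup>+e. (\<integral>\<^sup>+\<omega>. 1 + min (hit_time f x (f y e) \<omega>) (of_nat n) \<partial>stream_space M) \<partial>M)"
      using Suc.prems False
      by (subst nn_integral_stream_space) (auto simp: hit_time_Stream mn)
    also have "\<dots> = (\<integral>\<^sup>+e. 1 + mean_hit_upto x n (f y e) \<partial>M)"
      using Suc.prems
      by (intro nn_integral_cong, subst nn_integral_add)
         (auto simp: step_in st.emeasure_space_1 Suc.IH)
    finally show ?thesis using False Suc.prems by (simp add: nn_integral_one_plus)
  qed (simp add: hit_time_self)
qed

lemma mean_hit_SUP:
  assumes "y \<in> S"
  shows "mean_hit x y = (SUP n. mean_hit_upto x n y)"
proof -
  have sup: "a = (SUP n. min a (of_nat n))" for a :: ennreal
  proof -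
    have "(SUP n. inf a (of_nat n)) = inf a (SUP n. of_nat n)"
      by (rule inf_SUP[symmetric])
    then show ?thesis by (simp add: ennreal_SUP_of_nat_eq_top inf_min)
  qed
  have "mean_hit x y = (\<integral>\<^sup>+\<omega>. (SUP n. min (hit_time f x y \<omega>) (of_nat n)) \<partial>stream_space M)"
    unfolding mean_hit_def by (intro nn_integral_cong sup)
  also have "\<dots> = (SUP n. \<integral>\<^sup>+\<omega>. min (hit_time f x y \<omega>) (of_nat n) \<partial>stream_space M)"
    using assms
    by (intro nn_integral_monotone_convergence_SUP)
       (auto simp: incseq_def le_fun_def min_def intro: order_trans)
  finally show ?thesis using assms by (simp add: mean_hit_upto_eq)
qed

text \<open>
  The mean hitting time is the least nonnegative solution of \<open>h = 1 + K h\<close> off \<open>x\<close>, where \<open>K\<close>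
  averages over one step: by induction, the truncated means stay below any supersolution \<open>U\<close>.
\<close>

lemma mean_hit_le_supersolution:
  assumes U: "\<And>w. w \<in> S \<Longrightarrow> w \<noteq> x \<Longrightarrow> 1 + (\<integral>\<^sup>+e. U (f w e) \<partial>M) \<le> U w"
    and "y \<in> S"
  shows "mean_hit x y \<le> U y"
proof -
  have "mean_hit_upto x n w \<le> U w" if "w \<in> S" for n w
    using that
  proof (induction n arbitrary: w)
    case (Suc n)
    have "(\<integral>\<^sup>+e. mean_hit_upto x n (f w e) \<partial>M) \<le> (\<integral>\<^sup>+e. U (f w e) \<partial>M)"
      using Suc by (intro nn_integral_mono) (auto simp: step_in)
    then have "1 + (\<integral>\<^sup>+e. mean_hit_upto x n (f w e) \<partial>M) \<le> 1 + (\<integral>\<^sup>+e. U (f w e) \<partial>M)"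
      by (intro add_mono) auto
    also have "\<dots> \<le> U w" if "w \<noteq> x" using U that Suc.prems by simp
    finally show ?case by auto
  qed simp
  then show ?thesis using assms by (auto simp: mean_hit_SUP intro: SUP_least)
qed

text \<open>
  Optional stopping at the hitting time \<open>T\<close> of \<open>x\<close> in an integrable situation. Up to time \<open>n\<close>,
  subharmonicity gives \<open>g y \<le> E[g W\<^sub>n; T > n]\<close>, and by the domination this is at most
  \<open>C E[(T - n)\<^sup>+] = C (E T - E min(T, n))\<close>, which tends to \<open>0\<close>. Moving the subtracted term to the other
  side gives the inequality that is proved by induction.
\<close>

lemma subharmonic_vanishes:
  fixes g :: "'s \<Rightarrow> ennreal"
  assumes sub: "\<And>w. w \<in> S \<Longrightarrow> w \<noteq> x \<Longrightarrow> g w \<le> (\<integral>\<^sup>+e. g (f w e) \<partial>M)"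
    and gx: "g x = 0"
    and dom: "\<And>w. w \<in> S \<Longrightarrow> g w \<le> C * mean_hit x w"
    and C: "C < \<infinity>" and y: "y \<in> S" and fin: "mean_hit x y < \<infinity>"
  shows "g y = 0"
proof -
  have le: "g w + C * mean_hit_upto x n w \<le> C * mean_hit x w" if "w \<in> S" for n w
    using that
  proof (induction n arbitrary: w)
    case 0 then show ?case using dom by simp
  next
    case (Suc n)
    show ?case
    proof (cases "w = x")
      case False
      have "g w + C * mean_hit_upto x (Suc n) w
          = C + (g w + C * (\<integral>\<^sup>+e. mean_hit_upto x n (f w e) \<partial>M))"
        using False by (simp add: distrib_left ac_simps)
      also have "\<dots> \<le> C + ((\<integral>\<^sup>+e. g (f w e) \<partial>M) + C * (\<integral>\<^sup>+e. mean_hit_upto x n (f w e) \<partial>M))"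
        using sub[OF Suc.prems False] by (intro add_mono) auto
      also have "\<dots> = C + (\<integral>\<^sup>+e. g (f w e) + C * mean_hit_upto x n (f w e) \<partial>M)"
        using Suc.prems by (simp add: nn_integral_add nn_integral_cmult)
      also have "\<dots> \<le> C + (\<integral>\<^sup>+e. C * mean_hit x (f w e) \<partial>M)"
        using Suc by (intro add_mono nn_integral_mono) (auto simp: step_in)
      also have "\<dots> = C * mean_hit x w"
        using Suc.prems False
        by (simp add: nn_integral_cmult mean_hit_step[OF Suc.prems] distrib_left)
      finally show ?thesis .
    qed (simp add: gx)
  qed
  have "g y + C * mean_hit x y = (SUP n. g y + C * mean_hit_upto x n y)"
    using y by (simp add: mean_hit_SUP SUP_mult_left_ennreal ennreal_SUP_add_right)
  also have "\<dots> \<le> C * mean_hit x y" using le[OF y] by (rule SUP_least)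
  finally have "g y + C * mean_hit x y \<le> 0 + C * mean_hit x y" by simp
  moreover have "C * mean_hit x y \<noteq> \<top>" using C fin by (auto simp: ennreal_mult_eq_top_iff)
  ultimately show ?thesis
    by (simp add: ennreal_add_left_cancel_le add.commute)
qed

lemma mean_hit_upto_le: "y \<in> S \<Longrightarrow> mean_hit_upto x n y \<le> of_nat n"
proof -
  assume "y \<in> S"
  interpret st: prob_space "stream_space M" by (rule prob_space_stream_space)
  have "mean_hit_upto x n y \<le> (\<integral>\<^sup>+\<omega>. of_nat n \<partial>stream_space M)"
    unfolding mean_hit_upto_eq[OF \<open>y \<in> S\<close>] by (intro nn_integral_mono) auto
  then show ?thesis by (simp add: st.emeasure_space_1)
qed

text \<open>
  This is \<open>E min(T, n + 1) - E min(T, n) = P(T > n)\<close> without subtraction.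
\<close>

lemma mean_hit_upto_increment:
  "y \<in> S \<Longrightarrow> mean_hit_upto x (Suc n) y + hit_prob x n y = 1 + mean_hit_upto x n y"
proof (induction n arbitrary: y)
  case 0 then show ?case by simp
next
  case (Suc n)
  show ?case
  proof (cases "y = x")
    case False
    have "mean_hit_upto x (Suc (Suc n)) y + hit_prob x (Suc n) y
        = 1 + ((\<integral>\<^sup>+e. mean_hit_upto x (Suc n) (f y e) \<partial>M) + (\<integral>\<^sup>+e. hit_prob x n (f y e) \<partial>M))"
      unfolding mean_hit_upto.simps(2)[of x "Suc n" y] hit_prob.simps(2)
      using False by (simp add: add.assoc del: mean_hit_upto.simps)
    also have "\<dots> = 1 + (\<integral>\<^sup>+e. mean_hit_upto x (Suc n) (f y e) + hit_prob x n (f y e) \<partial>M)"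
      using Suc.prems by (simp add: nn_integral_add del: mean_hit_upto.simps)
    also have "(\<integral>\<^sup>+e. mean_hit_upto x (Suc n) (f y e) + hit_prob x n (f y e) \<partial>M)
        = (\<integral>\<^sup>+e. 1 + mean_hit_upto x n (f y e) \<partial>M)"
      using Suc by (intro nn_integral_cong) (auto simp: step_in simp del: mean_hit_upto.simps)
    also have "1 + \<dots> = 1 + mean_hit_upto x (Suc n) y"
      using False Suc.prems by (simp add: nn_integral_one_plus)
    finally show ?thesis .
  qed simp
qed

text \<open>
  Thus \<open>E min(T, n)\<close> is a bounded function whose one-step drift off \<open>x\<close> is exactly \<open>- P(T \<le> n)\<close>.
  It is the correction term in Foster's criterion below.
\<close>

lemma mean_hit_upto_drift:
  assumes "y \<in> S" "y \<noteq> x"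
  shows "(\<integral>\<^sup>+e. mean_hit_upto x n (f y e) \<partial>M) + hit_prob x n y = mean_hit_upto x n y"
proof -
  have "1 + ((\<integral>\<^sup>+e. mean_hit_upto x n (f y e) \<partial>M) + hit_prob x n y) = 1 + mean_hit_upto x n y"
    using mean_hit_upto_increment[OF assms(1), of x n] assms by (simp add: add.assoc)
  then show ?thesis by (simp add: ennreal_add_left_cancel)
qed

lemma hit_prob_Suc_ge: "y \<in> S \<Longrightarrow> hit_prob x n y \<le> hit_prob x (Suc n) y"
proof (induction n arbitrary: y)
  case (Suc n)
  then show ?case by (auto intro!: nn_integral_mono simp: step_in simp del: hit_prob.simps(1))
qed simp

lemma hit_prob_mono: "y \<in> S \<Longrightarrow> m \<le> n \<Longrightarrow> hit_prob x m y \<le> hit_prob x n y"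
  by (rule lift_Suc_mono_le[of "\<lambda>n. hit_prob x n y"]) (auto intro: hit_prob_Suc_ge simp del: hit_prob.simps)

definition reaches :: "'s \<Rightarrow> 's \<Rightarrow> bool" where
  "reaches y x \<longleftrightarrow> (\<exists>n. hit_prob x n y > 0)"

lemma reaches_refl: "reaches x x"
  unfolding reaches_def by (rule exI[of _ 0]) simp

text \<open>
  The target state of the step may depend on the input within \<open>E\<close>, hence so may the number of
  further steps; countable additivity over that number rules out that all of them fail almost surely.
\<close>

lemma reaches_step:
  assumes y: "y \<in> S" and E: "E \<in> sets M" "emeasure M E > 0"
    and r: "\<And>e. e \<in> E \<Longrightarrow> reaches (f y e) x"
  shows "reaches y x"
proof (rule ccontr)
  assume "\<not> reaches y x"
  then have z: "hit_prob x n y = 0" and "y \<noteq> x" for n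
    using reaches_refl[of x] by (auto simp: reaches_def)
  have "AE e in M. hit_prob x n (f y e) = 0" for n
    using z[of "Suc n"] \<open>y \<noteq> x\<close> y by (simp add: nn_integral_0_iff_AE)
  then have "AE e in M. \<forall>n. hit_prob x n (f y e) = 0" by (simp add: AE_all_countable)
  then have "AE e in M. e \<notin> E"
    by eventually_elim (metis r reaches_def less_irrefl)
  then have "emeasure M E = 0"
    using AE_iff_measurable[of E M "\<lambda>e. e \<notin> E"] E(1) sets.sets_into_space[OF E(1)] by auto
  with E show False by simp
qed

text \<open>
  Foster's criterion. A function \<open>L\<close> with drift at most \<open>-1\<close> outside a finite set \<open>F\<close> need not be a
  supersolution on \<open>F\<close>, where its drift is only at most \<open>1\<close>. Each state of \<open>F\<close> hits \<open>x\<close> within a common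
  number \<open>m\<close> of steps with probability at least \<open>\<delta> > 0\<close>, so adding \<open>(2 / \<delta>) E min(T, m)\<close> lowers the drift
  on \<open>F\<close> by \<open>2\<close> and raises it nowhere off \<open>x\<close>; the sum is a supersolution off \<open>x\<close>.
\<close>

lemma foster:
  fixes L :: "'s \<Rightarrow> ennreal"
  assumes fin: "\<And>w. w \<in> S \<Longrightarrow> L w < \<infinity>"
    and KL: "\<And>w. w \<in> S \<Longrightarrow> (\<integral>\<^sup>+e. L (f w e) \<partial>M) \<le> L w + 1"
    and F: "finite F" "F \<subseteq> S"
    and out: "\<And>w. w \<in> S - F \<Longrightarrow> 1 + (\<integral>\<^sup>+e. L (f w e) \<partial>M) \<le> L w"
    and x: "x \<in> S" and reach: "\<And>w. w \<in> F \<Longrightarrow> reaches w x"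
  shows "(\<integral>\<^sup>+\<omega>. return_time f x \<omega> \<partial>stream_space M) < \<infinity>"
proof -
  obtain n where n: "\<And>w. w \<in> F \<Longrightarrow> hit_prob x (n w) w > 0"
    using reach unfolding reaches_def by metis
  obtain m where m: "\<And>w. w \<in> F \<Longrightarrow> n w \<le> m"
    using F(1) finite_nat_set_iff_bounded_le[of "n ` F"] by auto
  have pos: "hit_prob x m w > 0" if "w \<in> F" for w
    using n[OF that] hit_prob_mono[of w "n w" m x] m[OF that] F that by fastforce
  define \<delta> where "\<delta> = Min (insert 1 (hit_prob x m ` F))"
  have \<delta>: "0 < \<delta>" "\<delta> \<le> 1" "\<And>w. w \<in> F \<Longrightarrow> \<delta> \<le> hit_prob x m w"
    unfolding \<delta>_def using F pos by (auto simp: Min_gr_iff)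
  obtain r where r: "\<delta> = ennreal r" "0 < r"
    using \<delta>(1,2) by (cases \<delta>) (auto simp: top_unique)
  define b where "b = ennreal (2 / r)"
  have b: "b < \<infinity>" "b * \<delta> = 2"
    unfolding b_def r(1) using r(2) by (auto simp flip: ennreal_mult)
  define U where "U w = L w + b * mean_hit_upto x m w" for w
  have KU: "(\<integral>\<^sup>+e. U (f w e) \<partial>M) = (\<integral>\<^sup>+e. L (f w e) \<partial>M) + b * (\<integral>\<^sup>+e. mean_hit_upto x m (f w e) \<partial>M)"
    if "w \<in> S" for w
    unfolding U_def using that by (simp add: nn_integral_add nn_integral_cmult)
  have "1 + (\<integral>\<^sup>+e. U (f w e) \<partial>M) \<le> U w" if w: "w \<in> S" "w \<noteq> x" for w
  proof -
    have "1 + (\<integral>\<^sup>+e. L (f w e) \<partial>M) \<le> L w + b * hit_prob x m w"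
    proof (cases "w \<in> F")
      case True
      have "1 + (\<integral>\<^sup>+e. L (f w e) \<partial>M) \<le> 1 + (L w + 1)"
        using KL[OF w(1)] by (intro add_mono) auto
      also have "\<dots> = L w + b * \<delta>" unfolding b(2) one_add_one[symmetric] by (simp add: ac_simps)
      also have "\<dots> \<le> L w + b * hit_prob x m w"
        using \<delta>(3)[OF True] by (intro add_mono mult_mono) auto
      finally show ?thesis .
    next
      case False
      then have "1 + (\<integral>\<^sup>+e. L (f w e) \<partial>M) \<le> L w + 0" using out[of w] w by simp
      also have "\<dots> \<le> L w + b * hit_prob x m w" by (intro add_mono) auto
      finally show ?thesis .
    qed
    then have "1 + (\<integral>\<^sup>+e. U (f w e) \<partial>M)
        \<le> (L w + b * hit_prob x m w) + b * (\<integral>\<^sup>+e. mean_hit_upto x m (f w e) \<partial>M)"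
      unfolding KU[OF w(1)] by (simp add: add_mono flip: add.assoc)
    also have "\<dots> = U w"
      unfolding U_def mean_hit_upto_drift[OF w, of m, symmetric]
      by (simp add: distrib_left ac_simps)
    finally show ?thesis .
  qed
  then have "mean_hit x w \<le> U w" if "w \<in> S" for w
    using that by (intro mean_hit_le_supersolution) auto
  then have "(\<integral>\<^sup>+e. mean_hit x (f x e) \<partial>M) \<le> (\<integral>\<^sup>+e. U (f x e) \<partial>M)"
    using x by (intro nn_integral_mono) (auto simp: step_in)
  also have "\<dots> \<le> (L x + 1) + b * (\<integral>\<^sup>+e. of_nat m \<partial>M)"
    unfolding KU[OF x] using x
    by (intro add_mono KL mult_left_mono nn_integral_mono) (auto simp: mean_hit_upto_le step_in)
  also have "\<dots> < \<infinity>"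
    using fin[OF x] b by (auto simp: emeasure_space_1 ennreal_mult_less_top of_nat_less_top)
  finally show ?thesis by (simp add: mean_return_time[OF x])
qed

end

section \<open>Dynamics of the class counts\<close>

lemma count_list_nths:
  "count_list (nths w A) j = card {i. i < length w \<and> i \<in> A \<and> w ! i = j}"
proof (induction w rule: rev_induct)
  case (snoc x w)
  have "{i. i < length (w @ [x]) \<and> i \<in> A \<and> (w @ [x]) ! i = j}
      = {i. i < length w \<and> i \<in> A \<and> w ! i = j} \<union> (if length w \<in> A \<and> x = j then {length w} else {})"
    by (auto simp: nth_append less_Suc_eq split: if_splits)
  then show ?case
    by (auto simp: snoc nths_append)
qed simp

lemma count_list_remove_positions:
  assumes P: "P \<subseteq> {..<length w}" and inj: "inj_on ((!) w) P"
  shows "count_list w j = count_list (nths w (- P)) j + (if j \<in> (!) w ` P then 1 else 0)"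
proof -
  have "count_list w j = card {i. i < length w \<and> w ! i = j}"
    using count_list_nths[of w UNIV j] by (simp add: nths_all)
  also have "{i. i < length w \<and> w ! i = j}
      = {i. i < length w \<and> i \<in> - P \<and> w ! i = j} \<union> {i \<in> P. w ! i = j}"
    using P by auto
  also have "card \<dots> = count_list (nths w (- P)) j + card {i \<in> P. w ! i = j}"
    unfolding count_list_nths using finite_subset[OF P] by (intro card_Un_disjoint) auto
  also have "card {i \<in> P. w ! i = j} = (if j \<in> (!) w ` P then 1 else 0)"
  proof (cases "j \<in> (!) w ` P")
    case True
    then obtain i where i: "i \<in> P" "j = w ! i" by auto
    then have "{i \<in> P. w ! i = j} = {i}" using inj by (auto simp: inj_on_def)
    then show ?thesis using True by simp
  next
    case False
    then have "{i \<in> P. w ! i = j} = {}" by auto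
    then show ?thesis using False by (simp only: card.empty if_False)
  qed
  finally show ?thesis .
qed

locale complete_matching_model =
  fixes V :: "'a set" and \<H> :: "'a set set" and \<Phi> :: "'a policy" and \<mu> :: "'a pmf"
  assumes complete: "complete_3_uniform V \<H>"
    and adm: "admissible V \<H> \<Phi>"
    and order: "3 \<le> card V"
    and full: "set_pmf \<mu> = V"
begin

abbreviation Q :: "'a list set" where "Q \<equiv> queue_details V \<H>"

lemma finite_V: "finite V"
  using complete by (simp add: complete_3_uniform_def hypergraph_def)

lemma hyperedge_iff: "H \<in> \<H> \<longleftrightarrow> H \<subseteq> V \<and> card H = 3"
  using complete by (auto simp: complete_3_uniform_def)

lemma in_Q_iff: "w \<in> Q \<longleftrightarrow> set w \<subseteq> V \<and> card (set w) \<le> 2"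
proof
  assume w: "w \<in> Q"
  then have sub: "set w \<subseteq> V" and ne: "\<And>H. H \<in> \<H> \<Longrightarrow> \<not> H \<subseteq> set w"
    by (auto simp: queue_details_def)
  have "card (set w) \<le> 2"
  proof (rule ccontr)
    assume "\<not> card (set w) \<le> 2"
    then obtain T where "T \<subseteq> set w" "card T = 3"
      using obtain_subset_with_card_n[of 3 "set w"] by auto
    with sub ne[of T] show False by (auto simp: hyperedge_iff)
  qed
  with sub show "set w \<subseteq> V \<and> card (set w) \<le> 2" by simp
next
  assume w: "set w \<subseteq> V \<and> card (set w) \<le> 2"
  have "\<not> H \<subseteq> set w" if "H \<in> \<H>" for H
    using that w card_mono[of "set w" H] by (auto simp: hyperedge_iff)
  with w show "w \<in> Q" by (auto simp: queue_details_def)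
qed

text \<open>
  A stored word has at most two classes, so a match takes one item of each stored class. The policy
  only chooses positions: the numbers of items of each class evolve independently of it.
\<close>

lemma match_classes:
  assumes w: "w \<in> Q" and P: "P \<in> matches \<H> w c"
  shows "c \<notin> set w" "card (set w) = 2" "(!) w ` P = set w"
proof -
  have sub: "(!) w ` P \<subseteq> set w" and c: "c \<notin> (!) w ` P" and H: "card (insert c ((!) w ` P)) = 3"
    using P by (auto simp: matches_def hyperedge_iff)
  have fin: "finite ((!) w ` P)" using finite_subset[OF sub] by simp
  then have two: "card ((!) w ` P) = 2" using c H by simp
  then show eq: "(!) w ` P = set w"
    using w sub by (intro card_seteq) (auto simp: in_Q_iff)
  show "c \<notin> set w" "card (set w) = 2" using c two by (auto simp: eq)
qed

lemma matches_nonempty_iff: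
  assumes w: "w \<in> Q" and c: "c \<in> V"
  shows "matches \<H> w c \<noteq> {} \<longleftrightarrow> c \<notin> set w \<and> card (set w) = 2"
proof
  assume "matches \<H> w c \<noteq> {}"
  then show "c \<notin> set w \<and> card (set w) = 2" using match_classes[OF w] by auto
next
  assume *: "c \<notin> set w \<and> card (set w) = 2"
  have "set w \<subseteq> (!) w ` {..<length w}" by (auto simp: in_set_conv_nth)
  then obtain P where P: "P \<subseteq> {..<length w}" "inj_on ((!) w) P" "set w = (!) w ` P"
    using subset_image_inj[of "set w" "(!) w" "{..<length w}"] by blast
  have "card (insert c (set w)) = 3" using * by simp
  moreover have "insert c (set w) \<subseteq> V" using w c by (auto simp: in_Q_iff)
  ultimately have "P \<in> matches \<H> w c"
    using P * by (simp add: matches_def hyperedge_iff)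
  then show "matches \<H> w c \<noteq> {}" by auto
qed

lemma sum_counts: "set w \<subseteq> V \<Longrightarrow> (\<Sum>j\<in>V. real (count_list w j)) = real (length w)"
  using sum_count_set[of w V] finite_V by (simp flip: of_nat_sum)

lemma arrival_store:
  assumes "w \<in> Q" "c \<in> V" "c \<in> set w \<or> card (set w) \<noteq> 2"
  shows "arrival \<H> \<Phi> w (c, u) = w @ [c]" "w @ [c] \<in> Q"
proof -
  show "arrival \<H> \<Phi> w (c, u) = w @ [c]"
    using assms matches_nonempty_iff[of w c] by (auto simp: arrival_def)
  show "w @ [c] \<in> Q"
    using assms by (auto simp: in_Q_iff insert_absorb card_insert_if)
qed

lemma arrival_match:
  assumes w: "w \<in> Q" and c: "c \<in> V" "c \<notin> set w" "card (set w) = 2" and u: "u \<in> {0..1}"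
  defines "w' \<equiv> arrival \<H> \<Phi> w (c, u)"
  shows "count_list w j = count_list w' j + (if j \<in> set w then 1 else 0)"
    and "length w = length w' + 2" and "w' \<in> Q"
proof -
  have ne: "matches \<H> w c \<noteq> {}" using matches_nonempty_iff[OF w] c by simp
  then have P: "\<Phi> w c u \<in> matches \<H> w c"
    using adm w c u by (auto simp: admissible_def)
  have w': "w' = nths w (- \<Phi> w c u)" using ne by (simp add: w'_def arrival_def)
  show cnt: "count_list w j = count_list w' j + (if j \<in> set w then 1 else 0)" for j
    using count_list_remove_positions[of "\<Phi> w c u" w j] P match_classes[OF w P]
    by (simp add: w' matches_def)
  show Q: "w' \<in> Q"
    unfolding in_Q_iff w'
    using w set_nths_subset[of w "- \<Phi> w c u"] card_mono[OF _ set_nths_subset[of w "- \<Phi> w c u"]]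
    by (auto simp: in_Q_iff)
  have sub: "set w \<subseteq> V" "set w' \<subseteq> V" using w Q by (auto simp: in_Q_iff)
  have "length w = (\<Sum>j\<in>V. count_list w j)" using sub finite_V by (simp add: sum_count_set)
  also have "\<dots> = (\<Sum>j\<in>V. count_list w' j) + (\<Sum>j\<in>V. if j \<in> set w then 1 else 0)"
    unfolding sum.distrib[symmetric] by (intro sum.cong cnt refl)
  also have "(\<Sum>j\<in>V. if j \<in> set w then 1 else 0) = card (set w)"
    using sub finite_V by (subst sum.inter_restrict[symmetric]) (auto simp: Int_absorb1)
  finally show "length w = length w' + 2"
    using sub finite_V c by (simp add: sum_count_set)
qed

lemma arrival_in_Q: "w \<in> Q \<Longrightarrow> c \<in> V \<Longrightarrow> u \<in> {0..1} \<Longrightarrow> arrival \<H> \<Phi> w (c, u) \<in> Q"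
  using arrival_match(3) arrival_store by metis

lemma length_arrival: "w \<in> Q \<Longrightarrow> c \<in> V \<Longrightarrow> u \<in> {0..1} \<Longrightarrow> length w \<le> length (arrival \<H> \<Phi> w (c, u)) + 2"
  using arrival_match(2)[of w c u] arrival_store(1)[of w c u] by fastforce

section \<open>Energy and excess\<close>

text \<open>
  With \<open>x\<close> and \<open>y\<close> items of two classes this is \<open>x\<^sup>2 - x y + y\<^sup>2\<close>. As a quadratic form in the vector
  of counts it vanishes at the indicator of every triple, and so does its polar form between that indicator
  and any counts supported in the triple. This is what makes removing a match neutral.
\<close>

definition energy :: "'a list \<Rightarrow> real" where
  "energy w = (3 * (\<Sum>j\<in>V. (real (count_list w j))\<^sup>2) - (real (length w))\<^sup>2) / 2"

lemma energy_nonneg: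
  assumes "w \<in> Q"
  shows "0 \<le> energy w"
proof -
  have sub: "set w \<subseteq> V" "card (set w) \<le> 2" using assms by (auto simp: in_Q_iff)
  let ?s = "\<Sum>j\<in>set w. (real (count_list w j))\<^sup>2"
  have sq: "(\<Sum>j\<in>V. (real (count_list w j))\<^sup>2) = ?s"
    using sub finite_V by (intro sum.mono_neutral_right) auto
  have "(real (length w))\<^sup>2 = (\<Sum>j\<in>set w. real (count_list w j))\<^sup>2"
    by (simp add: sum_count_set flip: of_nat_sum)
  also have "\<dots> \<le> ?s * real (card (set w))" by (rule sum_squared_le_sum_of_squares)
  also have "\<dots> \<le> ?s * 3" using sub by (intro mult_left_mono sum_nonneg) auto
  finally show ?thesis by (simp add: energy_def sq)
qed

text \<open>
  Removing a match leaves the energy unchanged, so the increment is the one of the added item alone,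
  whether or not it is matched.
\<close>

lemma energy_arrival:
  assumes w: "w \<in> Q" and c: "c \<in> V" and u: "u \<in> {0..1}"
  shows "energy (arrival \<H> \<Phi> w (c, u)) = energy w + (3 * real (count_list w c) - real (length w) + 1)"
proof (cases "c \<notin> set w \<and> card (set w) = 2")
  case False
  have "(\<Sum>j\<in>V. (real (count_list (w @ [c]) j))\<^sup>2)
      = (\<Sum>j\<in>V. (real (count_list w j))\<^sup>2 + (if j = c then 2 * real (count_list w c) + 1 else 0))"
    by (intro sum.cong) (auto simp: power2_eq_square algebra_simps)
  also have "\<dots> = (\<Sum>j\<in>V. (real (count_list w j))\<^sup>2) + (2 * real (count_list w c) + 1)"
    using c finite_V by (simp add: sum.distrib)
  finally show ?thesis
    using arrival_store(1)[OF w c] False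
    by (simp add: energy_def power2_eq_square field_simps)
next
  case True
  define w' where "w' = arrival \<H> \<Phi> w (c, u)"
  have cnt: "\<And>j. count_list w j = count_list w' j + (if j \<in> set w then 1 else 0)"
    and len: "length w = length w' + 2"
    using arrival_match[OF w c _ _ u] True unfolding w'_def by auto
  have sub: "set w \<subseteq> V" using w by (auto simp: in_Q_iff)
  have "(\<Sum>j\<in>V. (real (count_list w' j))\<^sup>2)
      = (\<Sum>j\<in>V. (real (count_list w j))\<^sup>2 - (if j \<in> set w then 2 * real (count_list w j) - 1 else 0))"
    by (intro sum.cong refl) (simp add: cnt power2_eq_square algebra_simps)
  also have "\<dots> = (\<Sum>j\<in>V. (real (count_list w j))\<^sup>2) - (\<Sum>j\<in>set w. 2 * real (count_list w j) - 1)"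
    unfolding sum_subtractf[of _ _ V] sum.inter_restrict[OF finite_V, symmetric]
    using sub by (simp only: Int_absorb1)
  also have "(\<Sum>j\<in>set w. 2 * real (count_list w j) - 1) = 2 * real (length w) - 2"
    using True by (simp add: sum_subtractf sum_count_set flip: of_nat_sum sum_distrib_left)
  finally have "(\<Sum>j\<in>V. (real (count_list w' j))\<^sup>2)
      = (\<Sum>j\<in>V. (real (count_list w j))\<^sup>2) - (2 * real (length w) - 2)" .
  moreover have "count_list w c = 0" using True by simp
  ultimately show ?thesis
    unfolding w'_def[symmetric] energy_def by (simp add: len power2_eq_square field_simps)
qed

text \<open>
  Removing a match leaves this unchanged if the hyperedge contains \<open>i\<close>, and raises it by \<open>3\<close> otherwise.
  So its increments dominate those of a random walk with steps \<open>2\<close> at arrivals of class \<open>i\<close> and \<open>-1\<close> at all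
  others, of mean \<open>3 \<mu>(i) - 1\<close>.
\<close>

definition excess :: "'a \<Rightarrow> 'a list \<Rightarrow> real" where
  "excess i w = 3 * real (count_list w i) - real (length w)"

lemma excess_arrival:
  assumes w: "w \<in> Q" and c: "c \<in> V" and u: "u \<in> {0..1}"
  shows "excess i w + (if c = i then 2 else - 1) \<le> excess i (arrival \<H> \<Phi> w (c, u))"
proof (cases "c \<notin> set w \<and> card (set w) = 2")
  case False
  then show ?thesis using arrival_store(1)[OF w c] by (simp add: excess_def)
next
  case True
  then show ?thesis
    using arrival_match(1)[OF w c _ _ u, of i] arrival_match(2)[OF w c _ _ u]
    by (auto simp: excess_def split: if_splits)
qed

section \<open>The chain of queue details\<close>

abbreviation inputs :: "('a \<times> real) measure" where
  "inputs \<equiv> measure_pmf \<mu> \<Otimes>\<^sub>M uniform_measure lborel {0..1}"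

text \<open>
  Outside \<open>V \<times> [0, 1]\<close>, the dynamics need neither be measurable nor preserve the state space. These inputs
  have probability \<open>0\<close>, and the modified chain ignores them.
\<close>

definition step :: "'a list \<Rightarrow> 'a \<times> real \<Rightarrow> 'a list" where
  "step w e = (if e \<in> V \<times> {0..1} then arrival \<H> \<Phi> w e else w)"

sublocale draw: prob_space "uniform_measure lborel {0..1::real}"
  by (rule prob_space_uniform_measure) auto

lemma box_in_sets: "A \<times> {0..1} \<in> sets inputs"
  by (rule pair_measureI) auto

lemma emeasure_box: "emeasure inputs (A \<times> {0..1}) = emeasure \<mu> A"
  by (subst draw.emeasure_pair_measure_Times) auto

lemma step_in_Q: "w \<in> Q \<Longrightarrow> step w e \<in> Q"
  by (cases e) (auto simp: step_def arrival_in_Q)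

lemma countable_Q: "countable Q"
  using finite_V by (intro countable_subset[of Q "lists V"]) (auto simp: queue_details_def countable_finite)

lemma step_measurable:
  assumes w: "w \<in> Q"
  shows "step w \<in> inputs \<rightarrow>\<^sub>M count_space Q"
  unfolding measurable_count_space_eq_countable[OF countable_Q]
proof (intro conjI ballI)
  show "step w \<in> space inputs \<rightarrow> Q" using step_in_Q[OF w] by auto
  fix a assume "a \<in> Q"
  have Phi: "\<Phi> w c \<in> borel \<rightarrow>\<^sub>M count_space UNIV" if "c \<in> V" for c
    using adm w that by (auto simp: admissible_def)
  have "(\<lambda>u. arrival \<H> \<Phi> w (c, u)) \<in> borel \<rightarrow>\<^sub>M count_space UNIV" if "c \<in> V" for c
    unfolding arrival_def
    using measurable_compose[OF Phi[OF that], of "\<lambda>P. nths w (- P)" "count_space UNIV"] by auto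
  then have B: "(\<lambda>u. arrival \<H> \<Phi> w (c, u)) -` {a} \<in> sets borel" if "c \<in> V" for c
    using measurable_sets[of _ borel "count_space UNIV" "{a}"] that by fastforce
  have "step w -` {a} \<inter> space inputs
      = (\<Union>c\<in>V. {c} \<times> ((\<lambda>u. arrival \<H> \<Phi> w (c, u)) -` {a} \<inter> {0..1}))
        \<union> (if a = w then space inputs - V \<times> {0..1} else {})"
    by (auto simp: step_def space_pair_measure split: if_splits)
  also have "\<dots> \<in> sets inputs"
    using B finite_V by (intro sets.Un sets.finite_UN pair_measureI) (auto intro: box_in_sets)
  finally show "step w -` {a} \<inter> space inputs \<in> sets inputs" .
qed

sublocale driven_chain inputs Q step
proof -
  interpret pair_prob_space "measure_pmf \<mu>" "uniform_measure lborel {0..1::real}" ..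
  show "driven_chain inputs Q step"
    by unfold_locales (rule countable_Q, rule step_measurable)
qed

lemma AE_inputs: "AE e in inputs. e \<in> V \<times> {0..1}"
proof -
  have "emeasure inputs (V \<times> {0..1}) = 1"
    using full by (simp add: emeasure_box measure_pmf.emeasure_eq_measure measure_pmf_UNIV
      measure_pmf.prob_eq_1 AE_measure_pmf_iff)
  then have "prob (V \<times> {0..1}) = 1" by (simp add: emeasure_eq_measure)
  then show ?thesis using box_in_sets by (simp add: prob_eq_1)
qed

lemma stable_iff_step:
  "stable V \<H> \<Phi> \<mu> \<longleftrightarrow>
    (\<forall>x\<in>Q. (\<integral>\<^sup>+\<omega>. return_time step x \<omega> \<partial>stream_space inputs) < \<infinity>)"
proof -
  have "AE \<omega> in stream_space inputs. stream_all (\<lambda>e. e \<in> V \<times> {0..1}) \<omega>"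
    using AE_inputs by (intro AE_stream_all) (use box_in_sets in auto)
  then have ae: "AE \<omega> in stream_space inputs. return_time (arrival \<H> \<Phi>) x \<omega> = return_time step x \<omega>" for x
  proof eventually_elim
    case (elim \<omega>)
    have "chain (arrival \<H> \<Phi>) x \<omega> n = chain step x \<omega> n" for n
      using elim by (induction n) (auto simp: step_def stream_all_def)
    then show ?case by (simp add: return_time_def)
  qed
  show ?thesis
    unfolding stable_def positive_recurrent_def using nn_integral_cong_AE[OF ae] by simp
qed

lemma nn_integral_class: "(\<integral>\<^sup>+e. h (fst e) \<partial>inputs) = (\<Sum>c\<in>V. h c * ennreal (pmf \<mu> c))"
proof -
  have "(\<integral>\<^sup>+e. h (fst e) \<partial>inputs) = (\<integral>\<^sup>+c. h c \<partial>\<mu>)"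
    by (subst draw.nn_integral_fst[symmetric]) (auto simp: draw.emeasure_space_1
        intro!: measurable_compose[OF measurable_fst])
  then show ?thesis using finite_V full by (simp add: nn_integral_measure_pmf_finite)
qed

lemma nn_integral_class_real:
  assumes "\<And>c. c \<in> V \<Longrightarrow> 0 \<le> h c"
  shows "(\<integral>\<^sup>+e. ennreal (h (fst e)) \<partial>inputs) = ennreal (\<Sum>c\<in>V. h c * pmf \<mu> c)"
proof -
  have "(\<integral>\<^sup>+e. ennreal (h (fst e)) \<partial>inputs) = (\<Sum>c\<in>V. ennreal (h c) * ennreal (pmf \<mu> c))"
    by (rule nn_integral_class)
  also have "\<dots> = (\<Sum>c\<in>V. ennreal (h c * pmf \<mu> c))"
    by (intro sum.cong refl ennreal_mult[symmetric] assms) auto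
  also have "\<dots> = ennreal (\<Sum>c\<in>V. h c * pmf \<mu> c)"
    by (intro sum_ennreal mult_nonneg_nonneg assms) auto
  finally show ?thesis .
qed

lemma sum_pmf: "(\<Sum>c\<in>V. pmf \<mu> c) = 1"
  using full finite_V by (simp add: sum_pmf_eq_1)

lemma reaches_class:
  assumes w: "w \<in> Q" and c: "c \<in> V" and r: "\<And>u. u \<in> {0..1} \<Longrightarrow> reaches (arrival \<H> \<Phi> w (c, u)) x"
  shows "reaches w x"
proof (rule reaches_step[OF w, of "{c} \<times> {0..1}"])
  show "0 < emeasure inputs ({c} \<times> {0..1})"
    using c full by (simp add: emeasure_box emeasure_pmf_single pmf_positive)
qed (use c r in \<open>auto simp: box_in_sets step_def\<close>)

section \<open>Irreducibility\<close>

text \<open>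
  The prefixes of a word with at most two classes also have at most two classes, so no item is matched
  while the word is being built.
\<close>

lemma reaches_from_empty:
  assumes x: "x \<in> Q"
  shows "reaches [] x"
proof -
  have "k \<le> length x \<Longrightarrow> reaches (take k x) x" for k
  proof (induction rule: inc_induct)
    case base then show ?case by (simp add: reaches_refl)
  next
    case (step k)
    have eq: "take k x @ [x ! k] = take (Suc k) x" using step by (simp add: take_Suc_conv_app_nth)
    have sub: "set (take k x) \<subseteq> set x" by (rule set_take_subset)
    have Q: "take k x \<in> Q" and c: "x ! k \<in> V"
      using x sub step card_mono[OF _ sub] nth_mem[of k x] by (auto simp: in_Q_iff)
    have "x ! k \<in> set (take k x) \<or> card (set (take k x)) \<noteq> 2"
    proof (rule ccontr)
      assume "\<not> ?thesis"
      then have "card (set (take (Suc k) x)) = 3" by (simp flip: eq)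
      moreover have "card (set (take (Suc k) x)) \<le> card (set x)"
        by (intro card_mono set_take_subset) auto
      ultimately show False using x by (simp add: in_Q_iff)
    qed
    then show ?case using arrival_store(1)[OF Q c] step.IH eq by (intro reaches_class[OF Q c]) simp
  qed
  from this[of 0] show ?thesis by simp
qed

lemma obtain_other_class:
  assumes "card A \<le> 2" "finite A"
  obtains c where "c \<in> V" "c \<notin> A"
  using assms order card_mono[of A V] by (metis le_trans not_less_eq_eq numeral_2_eq_2 numeral_3_eq_3 subsetI)

text \<open>
  From two stored classes, a third class forces a match. From one stored class, a second one
  is added first, which makes the word longer, but the match after it shortens the word below its
  original length. So the empty word is reached, and any word is then built letter by letter.
\<close>

lemma reaches_all:
  assumes x: "x \<in> Q"
  shows "w \<in> Q \<Longrightarrow> reaches w x"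
proof (induction "length w" arbitrary: w rule: less_induct)
  case less
  have two: "reaches v x" if v: "v \<in> Q" "card (set v) = 2" "length v \<le> Suc (length w)" for v
  proof -
    obtain c where c: "c \<in> V" "c \<notin> set v" using obtain_other_class[of "set v"] v by auto
    show ?thesis
    proof (rule reaches_class[OF v(1) c(1)])
      fix u :: real assume u: "u \<in> {0..1}"
      have "length v = length (arrival \<H> \<Phi> v (c, u)) + 2" "arrival \<H> \<Phi> v (c, u) \<in> Q"
        using arrival_match[OF v(1) c v(2) u] by auto
      then show "reaches (arrival \<H> \<Phi> v (c, u)) x" using v(3) by (intro less.hyps) auto
    qed
  qed
  consider "w = []" | "card (set w) = 1" | "card (set w) = 2"
    using less.prems by (cases "card (set w)") (auto simp: in_Q_iff le_Suc_eq numeral_2_eq_2)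
  then show ?case
  proof cases
    case 1 then show ?thesis using reaches_from_empty[OF x] by simp
  next
    case 2
    obtain c where c: "c \<in> V" "c \<notin> set w" using obtain_other_class[of "set w"] 2 by auto
    have "reaches (w @ [c]) x"
      using arrival_store(2)[OF less.prems c(1)] 2 c(2) by (intro two) auto
    then show ?thesis
      using arrival_store(1)[OF less.prems c(1)] 2 by (intro reaches_class[OF less.prems c(1)]) auto
  next
    case 3 then show ?thesis using two[OF less.prems] by simp
  qed
qed

section \<open>Stability below one third\<close>

text \<open>
  The increment at an arrival of class \<open>c\<close> is \<open>3 n\<^sub>c - N + 1\<close>, of mean
  \<open>1 - (\<Sum>c. n\<^sub>c (1 - 3 \<mu>(c)))\<close>. The second claim, which holds because the mean energy
  after the step is nonnegative, shows that the energy is large where its drift is negative.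
\<close>

lemma energy_drift:
  assumes w: "w \<in> Q" and \<epsilon>: "\<And>c. c \<in> V \<Longrightarrow> 3 * pmf \<mu> c \<le> 1 - \<epsilon>"
  shows "(\<integral>\<^sup>+e. ennreal (energy (step w e)) \<partial>inputs) \<le> ennreal (energy w + 1 - \<epsilon> * real (length w))"
    and "0 \<le> energy w + 1 - \<epsilon> * real (length w)"
proof -
  let ?h = "\<lambda>c. energy w + (3 * real (count_list w c) - real (length w) + 1)"
  have nonneg: "0 \<le> ?h c" if "c \<in> V" for c
    using energy_nonneg[OF arrival_in_Q[OF w that, of 0]] energy_arrival[OF w that, of 0] by simp
  have "(\<integral>\<^sup>+e. ennreal (energy (step w e)) \<partial>inputs) = (\<integral>\<^sup>+e. ennreal (?h (fst e)) \<partial>inputs)"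
    by (rule nn_integral_cong_AE) (use AE_inputs in eventually_elim, auto simp: step_def energy_arrival w)
  also have "\<dots> = ennreal (\<Sum>c\<in>V. ?h c * pmf \<mu> c)" by (rule nn_integral_class_real[OF nonneg])
  finally have int: "(\<integral>\<^sup>+e. ennreal (energy (step w e)) \<partial>inputs) = ennreal (\<Sum>c\<in>V. ?h c * pmf \<mu> c)" .
  have "(\<Sum>c\<in>V. ?h c * pmf \<mu> c)
      = (\<Sum>c\<in>V. (energy w - real (length w) + 1) * pmf \<mu> c + real (count_list w c) * (3 * pmf \<mu> c))"
    by (intro sum.cong) (auto simp: algebra_simps)
  also have "\<dots> = (energy w - real (length w) + 1) + (\<Sum>c\<in>V. real (count_list w c) * (3 * pmf \<mu> c))"
    by (simp only: sum.distrib sum_distrib_left[symmetric] sum_pmf mult_1_right)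
  also have "(\<Sum>c\<in>V. real (count_list w c) * (3 * pmf \<mu> c)) \<le> (\<Sum>c\<in>V. real (count_list w c) * (1 - \<epsilon>))"
    by (intro sum_mono mult_left_mono \<epsilon>) auto
  also have "\<dots> = real (length w) * (1 - \<epsilon>)"
    using w by (simp add: sum_counts in_Q_iff flip: sum_distrib_right)
  finally have le: "(\<Sum>c\<in>V. ?h c * pmf \<mu> c) \<le> energy w + 1 - \<epsilon> * real (length w)"
    by (simp add: algebra_simps)
  show "(\<integral>\<^sup>+e. ennreal (energy (step w e)) \<partial>inputs) \<le> ennreal (energy w + 1 - \<epsilon> * real (length w))"
    unfolding int by (rule ennreal_leI[OF le])
  have "0 \<le> (\<Sum>c\<in>V. ?h c * pmf \<mu> c)" by (intro sum_nonneg mult_nonneg_nonneg nonneg) auto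
  with le show "0 \<le> energy w + 1 - \<epsilon> * real (length w)" by linarith
qed

lemma stable_if_all_below_third:
  assumes "\<forall>i\<in>V. pmf \<mu> i < 1 / 3"
  shows "stable V \<H> \<Phi> \<mu>"
  unfolding stable_iff_step
proof
  fix x assume x: "x \<in> Q"
  have ne: "V \<noteq> {}" using order by auto
  define \<epsilon> where "\<epsilon> = Min ((\<lambda>c. 1 - 3 * pmf \<mu> c) ` V)"
  have pos: "0 < \<epsilon>" using assms ne finite_V by (auto simp: \<epsilon>_def Min_gr_iff)
  have le: "3 * pmf \<mu> c \<le> 1 - \<epsilon>" if "c \<in> V" for c
  proof -
    have "\<epsilon> \<le> 1 - 3 * pmf \<mu> c" unfolding \<epsilon>_def using finite_V that by (intro Min_le) auto
    then show ?thesis by simp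
  qed
  define F where "F = {w \<in> Q. \<epsilon> * real (length w) \<le> 2}"
  show "(\<integral>\<^sup>+\<omega>. return_time step x \<omega> \<partial>stream_space inputs) < \<infinity>"
  proof (rule foster[where L="\<lambda>w. ennreal (energy w)" and F=F])
    have "real (length w) \<le> 2 / \<epsilon>" if "w \<in> F" for w
      using that pos by (simp add: F_def field_simps)
    then have "F \<subseteq> {w. set w \<subseteq> V \<and> length w \<le> nat \<lceil>2 / \<epsilon>\<rceil>}"
      by (auto simp: F_def in_Q_iff) (metis le_nat_iff nat_ceiling_le_eq of_nat_le_iff order_trans real_nat_ceiling_ge)
    then show "finite F" using finite_lists_length_le[OF finite_V] finite_subset by blast
    show "F \<subseteq> Q" by (auto simp: F_def)
    show "reaches w x" if "w \<in> F" for w using that reaches_all[OF x] by (auto simp: F_def)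
    show "(\<integral>\<^sup>+e. ennreal (energy (step w e)) \<partial>inputs) \<le> ennreal (energy w) + 1" if w: "w \<in> Q" for w
    proof -
      have "(\<integral>\<^sup>+e. ennreal (energy (step w e)) \<partial>inputs) \<le> ennreal (energy w + 1 - \<epsilon> * real (length w))"
        by (rule energy_drift(1)[OF w le])
      also have "\<dots> \<le> ennreal (energy w + 1)" using pos by (intro ennreal_leI) simp
      finally show ?thesis using energy_nonneg[OF w] by (simp add: ennreal_plus)
    qed
    show "1 + (\<integral>\<^sup>+e. ennreal (energy (step w e)) \<partial>inputs) \<le> ennreal (energy w)" if w: "w \<in> Q - F" for w
    proof -
      have wQ: "w \<in> Q" and big: "2 < \<epsilon> * real (length w)" using w by (auto simp: F_def)
      have le1: "(\<integral>\<^sup>+e. ennreal (energy (step w e)) \<partial>inputs) \<le> ennreal (energy w + 1 - \<epsilon> * real (length w))"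
        by (rule energy_drift(1)[OF wQ le])
      have "1 \<le> energy w" using energy_drift(2)[OF wQ le] big by simp
      have "1 + (\<integral>\<^sup>+e. ennreal (energy (step w e)) \<partial>inputs) \<le> 1 + ennreal (energy w - 1)"
        using big by (intro add_mono order_trans[OF le1] ennreal_leI) auto
      also have "\<dots> = ennreal (energy w)"
        using \<open>1 \<le> energy w\<close> by (simp flip: ennreal_1 ennreal_plus)
      finally show ?thesis .
    qed
  qed (use x in auto)
qed

section \<open>Instability from one third on\<close>

text \<open>
  At most two stored items leave at a time.
\<close>

lemma length_le_hit_time: "w \<in> Q \<Longrightarrow> of_nat (length w) \<le> 2 * hit_time step [] w \<omega>"
proof -
  assume w: "w \<in> Q"
  have inQ: "chain step w \<omega> n \<in> Q" for n by (induction n) (auto simp: w step_in_Q)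
  have len: "length w \<le> length (chain step w \<omega> n) + 2 * n" for n
  proof (induction n)
    case (Suc n)
    have "length (chain step w \<omega> n) \<le> length (step (chain step w \<omega> n) (\<omega> !! n)) + 2"
      using length_arrival[OF inQ[of n], of "fst (\<omega> !! n)" "snd (\<omega> !! n)"]
      by (auto simp: step_def mem_Times_iff)
    with Suc show ?case by simp
  qed simp
  have "ennreal (real (length w) / 2) \<le> hit_time step [] w \<omega>"
    unfolding hit_time_def
  proof (rule INF_greatest)
    fix n
    show "ennreal (real (length w) / 2) \<le> (if chain step w \<omega> n = [] then of_nat n else (\<top>::ennreal))"
    proof (cases "chain step w \<omega> n = []")
      case True
      then have "real (length w) / 2 \<le> real n" using len[of n] by simp
      then have "ennreal (real (length w) / 2) \<le> of_nat n"
        unfolding ennreal_of_nat_eq_real_of_nat by (rule ennreal_leI)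
      then show ?thesis using True by simp
    qed simp
  qed
  then have "ennreal 2 * ennreal (real (length w) / 2) \<le> ennreal 2 * hit_time step [] w \<omega>"
    by (rule mult_left_mono) simp
  moreover have "ennreal 2 * ennreal (real (length w) / 2) = of_nat (length w)"
    by (subst ennreal_mult[symmetric]) (auto simp: ennreal_of_nat_eq_real_of_nat)
  ultimately show ?thesis by simp
qed

text \<open>
  If \<open>\<mu>(i) \<ge> 1/3\<close>, the positive part of the excess of \<open>i\<close> is subharmonic. It is at most twice the length of the
  word, hence at most four times the time to empty the system. If that time had finite mean from the
  word \<open>[i]\<close>, the excess \<open>2\<close> of this word would have to be \<open>0\<close>.
\<close>

lemma below_third_if_stable:
  assumes st: "stable V \<H> \<Phi> \<mu>" and i: "i \<in> V"
  shows "pmf \<mu> i < 1 / 3"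
proof (rule ccontr)
  assume "\<not> pmf \<mu> i < 1 / 3"
  then have ge: "1 / 3 \<le> pmf \<mu> i" by simp
  have Nil: "[] \<in> Q" and single: "[i] \<in> Q" using i by (auto simp: in_Q_iff)
  \<comment> \<open>From the empty word the chain moves to \<open>[i]\<close> with positive probability.\<close>
  have fin: "mean_hit [] [i] < \<infinity>"
  proof -
    have "mean_hit [] [i] * emeasure inputs ({i} \<times> {0..1})
        = (\<integral>\<^sup>+e. mean_hit [] [i] * indicator ({i} \<times> {0..1}) e \<partial>inputs)"
      by (simp add: nn_integral_cmult_indicator box_in_sets)
    also have "\<dots> \<le> (\<integral>\<^sup>+e. mean_hit [] (step [] e) \<partial>inputs)"
      using arrival_store(1)[OF Nil i]
      by (intro nn_integral_mono) (auto simp: step_def i split: split_indicator)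
    also have "\<dots> < \<infinity>"
    proof -
      have "(\<integral>\<^sup>+\<omega>. return_time step [] \<omega> \<partial>stream_space inputs) < \<infinity>"
        using st Nil unfolding stable_iff_step by blast
      then show ?thesis unfolding mean_return_time[OF Nil] by simp
    qed
    finally have "mean_hit [] [i] * ennreal (pmf \<mu> i) < \<infinity>"
      by (simp only: emeasure_box emeasure_pmf_single)
    moreover have "pmf \<mu> i > 0" using i full by (simp add: pmf_positive)
    ultimately show ?thesis by (auto simp: ennreal_mult_less_top)
  qed
  have "ennreal (excess i [i]) = 0"
  proof (rule subharmonic_vanishes[where C=4 and g="\<lambda>w. ennreal (excess i w)", OF _ _ _ _ single fin])
    show "ennreal (excess i w) \<le> (\<integral>\<^sup>+e. ennreal (excess i (step w e)) \<partial>inputs)" if w: "w \<in> Q" for w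
    proof (cases "excess i w \<le> 0")
      case True then show ?thesis by (simp add: ennreal_neg)
    next
      case False
      \<comment> \<open>The excess is an integer, so each term below is nonnegative.\<close>
      then have "length w < 3 * count_list w i" by (simp add: excess_def)
      then have one: "1 \<le> excess i w" by (simp add: excess_def)
      let ?h = "\<lambda>c. excess i w + (if c = i then 2 else - 1)"
      have "(\<Sum>c\<in>V. ?h c * pmf \<mu> c) = (\<Sum>c\<in>V. (excess i w - 1) * pmf \<mu> c + (if c = i then 3 * pmf \<mu> i else 0))"
        by (intro sum.cong) (auto simp: algebra_simps)
      also have "\<dots> = excess i w - 1 + 3 * pmf \<mu> i"
        using i finite_V by (simp add: sum.distrib sum_pmf flip: sum_distrib_left)
      finally have "ennreal (excess i w) \<le> ennreal (\<Sum>c\<in>V. ?h c * pmf \<mu> c)"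
        using ge by (intro ennreal_leI) simp
      also have "\<dots> = (\<integral>\<^sup>+e. ennreal (?h (fst e)) \<partial>inputs)"
        using one by (intro nn_integral_class_real[symmetric]) auto
      also have "\<dots> \<le> (\<integral>\<^sup>+e. ennreal (excess i (step w e)) \<partial>inputs)"
      proof (rule nn_integral_mono_AE, use AE_inputs in eventually_elim)
        fix e :: "'a \<times> real" assume e: "e \<in> V \<times> {0..1}"
        then have "?h (fst e) \<le> excess i (step w e)"
          using excess_arrival[OF w, of "fst e" "snd e" i] by (auto simp: step_def)
        then show "ennreal (?h (fst e)) \<le> ennreal (excess i (step w e))" by (rule ennreal_leI)
      qed
      finally show ?thesis .
    qed
    show "ennreal (excess i w) \<le> 4 * mean_hit [] w" if w: "w \<in> Q" for w
    proof -
      interpret st: prob_space "stream_space inputs" by (rule prob_space_stream_space)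
      have "excess i w \<le> 2 * real (length w)"
        using count_le_length[of w i] by (simp add: excess_def)
      then have "ennreal (excess i w) \<le> 2 * of_nat (length w)"
        by (metis ennreal_leI ennreal_mult ennreal_numeral ennreal_of_nat_eq_real_of_nat of_nat_0_le_iff
            zero_le_numeral)
      also have "\<dots> = (\<integral>\<^sup>+\<omega>. 2 * of_nat (length w) \<partial>stream_space inputs)"
        by (simp add: st.emeasure_space_1)
      also have "\<dots> \<le> (\<integral>\<^sup>+\<omega>. 2 * (2 * hit_time step [] w \<omega>) \<partial>stream_space inputs)"
        by (intro nn_integral_mono mult_left_mono length_le_hit_time[OF w]) auto
      also have "\<dots> = 4 * mean_hit [] w"
        using w by (simp add: mean_hit_def nn_integral_cmult flip: mult.assoc)
      finally show ?thesis .
    qed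
  qed (auto simp: excess_def)
  then show False by (simp add: excess_def)
qed

end

theorem theorem4p1:
  fixes V :: "'a set" and \<H> :: "'a set set" and \<Phi> :: "'a policy"
  assumes "complete_3_uniform V \<H>"
    and "card V \<ge> 4"
    and "admissible V \<H> \<Phi>"
  shows "Stab V \<H> \<Phi> = {\<mu> \<in> full_measures V. \<forall>i\<in>V. pmf \<mu> i < 1 / 3}"
proof -
  have "stable V \<H> \<Phi> \<mu> \<longleftrightarrow> (\<forall>i\<in>V. pmf \<mu> i < 1 / 3)" if "\<mu> \<in> full_measures V" for \<mu>
  proof -
    interpret complete_matching_model V \<H> \<Phi> \<mu>
      using assms that by unfold_locales (auto simp: full_measures_def)
    show ?thesis using stable_if_all_below_third below_third_if_stable by blast
  qed
  then show ?thesis by (auto simp: Stab_def)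
qed

end
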